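(* Assume that the game mapping $F$ is single-valued and continuous. Then the operator $\mathcal R^\top\boldsymbol F$ is maximally monotone if and only if, for all $i\in\mathcal I$, the gradient $\nabla_{x_i}f_i(\cdot,x_{-i})$ is independent of $x_{-i}$ (i.e., $\nabla_{x_i}f_i(x_i,x_{-i})=\nabla_{x_i}f_i(x_i,x_{-i}')$ for all $x_i\in\mathbb R^{n_i}$ and all $x_{-i},x_{-i}'\in\mathbb R^{n-n_i}$).
   Context: Game. $\mathcal I=\{1,\dots,N\}$ is a set of agents; agent $i$ has strategy $x_i\in\mathcal X_i\subseteq\mathbb R^{n_i}$; $n=\sum_i n_i$, $x=\operatorname{col}((x_i)_{i\in\mathcal I})\in\mathbb R^n$ (stacked vector), $x_{-i}=\operatorname{col}((x_j)_{j\ne i})$. Agent $i$ has cost $f_i:\mathbb R^n\to\mathbb R$, written $f_i(x_i,x_{-i})$. Standing assumption. For each $i$, $\mathcal X_i$ is nonempty, closed and convex; $f_i$ is continuous and $f_i(\cdot,x_{-i})$ is convex for every $x_{-i}$. Operators. $\partial_{x_i}f_i$ is the convex subdifferential with respect to the own strategy. The game mapping is $F:\mathbb R^n\rightrightarrows\mathbb R^n$, $F(x)=\operatorname{col}((\partial_{x_i}f_i(x_i,x_{-i}))_{i\in\mathcal I})$; when $F$ is single-valued, $\partial_{x_i}f_i=\nabla_{x_i}f_i$. For $\boldsymbol x=\operatorname{col}((\boldsymbol x_i)_{i\in\mathcal I})\in\mathbb R^{Nn}$ with $\boldsymbol x_i=\operatorname{col}((\boldsymbol x_{i,j})_{j\in\mathcal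 I})\in\mathbb R^n$, $\boldsymbol x_{i,j}\in\mathbb R^{n_j}$, $\boldsymbol x_{i,i}=x_i$, $\boldsymbol x_{i,-i}=\operatorname{col}((\boldsymbol x_{i,j})_{j\neq i})$, the extended game mapping is $\boldsymbol F(\boldsymbol x)=\operatorname{col}((\partial_{x_i}f_i(x_i,\boldsymbol x_{i,-i}))_{i\in\mathcal I})\subseteq\mathbb R^n$. $\mathcal R_i\in\mathbb R^{n_i\times n}$ is the matrix selecting the $i$-th block of a vector in $\mathbb R^n$, and $\mathcal R=\operatorname{diag}((\mathcal R_i)_{i\in\mathcal I})\in\mathbb R^{n\times Nn}$, so $\mathcal R\boldsymbol x=\operatorname{col}((x_i)_i)$; $\mathcal R^\top\boldsymbol F$ is an operator on $\mathbb R^{Nn}$. An operator $\mathcal F:\mathbb R^q\rightrightarrows\mathbb R^q$ is monotone if $\langle u-v,x-y\rangle\ge0$ for all $(x,u),(y,v)$ in its graph, and maximally monotone if it is monotone and its graph is not strictly contained in the graph of another monotone operator. *)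

theory Defs
  imports "HOL-Analysis.Analysis"
begin

text \<open>
  A partition of the coordinates among the agents: \<open>own k\<close> is the agent owning coordinate \<open>k\<close>.
  The coordinate type \<open>'m\<close> gives \<open>n = CARD('m)\<close>, the agent type \<open>'a\<close> gives \<open>N = CARD('a)\<close>, and
  \<open>n\<^sub>i\<close> is the number of coordinates owned by \<open>i\<close>. The space of own strategies of agent \<open>i\<close>
  (\<open>n\<^sub>i\<close>-dimensional) is represented by the coordinate subspace \<open>block own i\<close>.
\<close>

definition block :: "('m \<Rightarrow> 'a) \<Rightarrow> 'a \<Rightarrow> (real ^ 'm::finite) set" where
  "block own i = {x. \<forall>k. own k \<noteq> i \<longrightarrow> x $ k = 0}"

text \<open>\<open>f (join own i x y)\<close> is what is usually written \<open>f (x\<^sub>i, y\<^sub>-\<^sub>i)\<close>; moreover,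
  \<open>join own i x 0\<close> is the \<open>i\<close>-th block of \<open>x\<close>.\<close>

definition join :: "('m \<Rightarrow> 'a) \<Rightarrow> 'a \<Rightarrow> real ^ 'm \<Rightarrow> real ^ 'm \<Rightarrow> real ^ 'm::finite" where
  "join own i x y = (\<chi> k. if own k = i then x $ k else y $ k)"

definition own_subdiff ::
    "('m \<Rightarrow> 'a) \<Rightarrow> 'a \<Rightarrow> (real ^ 'm \<Rightarrow> real) \<Rightarrow> real ^ 'm \<Rightarrow> (real ^ 'm::finite) set" where
  "own_subdiff own i \<phi> x =
     {g \<in> block own i. \<forall>y \<in> block own i.
        \<phi> (join own i y x) \<ge> \<phi> x + g \<bullet> (y - join own i x 0)}"

text \<open>The differentiated function is constant in the coordinates of the other agents, so its
  gradient lies in \<open>block own i\<close>.\<close>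

definition own_grad ::
    "('m \<Rightarrow> 'a) \<Rightarrow> 'a \<Rightarrow> (real ^ 'm \<Rightarrow> real) \<Rightarrow> real ^ 'm \<Rightarrow> real ^ 'm::finite" where
  "own_grad own i \<phi> x = (THE g. GDERIV (\<lambda>y. \<phi> (join own i y x)) x :> g)"

definition game_map ::
    "('m \<Rightarrow> 'a) \<Rightarrow> ('a \<Rightarrow> real ^ 'm \<Rightarrow> real) \<Rightarrow> real ^ 'm \<Rightarrow> (real ^ 'm::finite) set" where
  "game_map own f x = {u. \<forall>i. join own i u 0 \<in> own_subdiff own i (f i) x}"

text \<open>A stacked vector of estimates has coordinates indexed by pairs \<open>(i, k)\<close>; its \<open>i\<close>-th block
  is agent \<open>i\<close>'s estimate of the whole strategy profile.\<close>

definition estimate :: "'a \<Rightarrow> real ^ ('a::finite \<times> 'm) \<Rightarrow> real ^ 'm::finite" where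
  "estimate i z = (\<chi> k. z $ (i, k))"

definition ext_game_map ::
    "('m \<Rightarrow> 'a) \<Rightarrow> ('a \<Rightarrow> real ^ 'm \<Rightarrow> real) \<Rightarrow> real ^ ('a::finite \<times> 'm) \<Rightarrow> (real ^ 'm::finite) set" where
  "ext_game_map own f z = {u. \<forall>i. join own i u 0 \<in> own_subdiff own i (f i) (estimate i z)}"

text \<open>The block-diagonal matrix of the block selectors: row \<open>k\<close>, which belongs to the selector of
  agent \<open>own k\<close>, picks the \<open>k\<close>-th entry of that agent's estimate.\<close>

definition selection :: "('m \<Rightarrow> 'a) \<Rightarrow> real ^ ('a::finite \<times> 'm) ^ ('m::finite)" where
  "selection own = (\<chi> k. \<chi> p. if p = (own k, k) then 1 else 0)"

lemma selection_mult: "selection own *v z = (\<chi> k. z $ (own k, k))"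
  by (simp add: selection_def matrix_vector_mult_def vec_eq_iff if_distrib[of "\<lambda>c. c * _"]
      cong: if_cong)

definition op_graph :: "('v \<Rightarrow> 'v set) \<Rightarrow> ('v \<times> 'v) set" where
  "op_graph A = {(x, u). u \<in> A x}"

definition monotone_op :: "('v::real_inner \<Rightarrow> 'v set) \<Rightarrow> bool" where
  "monotone_op A \<longleftrightarrow>
     (\<forall>(x, u) \<in> op_graph A. \<forall>(y, v) \<in> op_graph A. (u - v) \<bullet> (x - y) \<ge> 0)"

definition maximally_monotone_op :: "('v::real_inner \<Rightarrow> 'v set) \<Rightarrow> bool" where
  "maximally_monotone_op A \<longleftrightarrow>
     monotone_op A \<and> \<not> (\<exists>B. monotone_op B \<and> op_graph A \<subset> op_graph B)"

end

theory Submission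
  imports Defs
begin

text \<open>
  Write \<open>G\<close> for the single-valued game mapping. The operator in question is then the single-valued
  continuous map \<open>z \<mapsto> \<R>\<^sup>T (G\<^sub>i (z\<^sub>i))\<^sub>i\<close>, and a continuous map is maximally monotone as soon as it is
  monotone (Minty's trick). Its monotonicity decouples over the agents into
  \<open>\<langle>G\<^sub>i x - G\<^sub>i y, x\<^sub>i - y\<^sub>i\<rangle> \<ge> 0\<close> for arbitrary profiles \<open>x\<close>, \<open>y\<close>. Since \<open>x\<^sub>-\<^sub>i\<close> and \<open>y\<^sub>-\<^sub>i\<close> are
  unrelated, letting \<open>y\<^sub>i \<rightarrow> x\<^sub>i\<close> from all directions forces \<open>G\<^sub>i\<close> not to depend on the other agents;
  conversely, this independence reduces the inequality to the monotonicity of a subdifferential.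
\<close>

lemma join_join [simp]: "join own i x (join own i y z) = join own i x z"
  by (simp add: join_def vec_eq_iff)

lemma join_join_left [simp]: "join own i (join own i x y) z = join own i x z"
  by (simp add: join_def vec_eq_iff)

lemma join_self [simp]: "join own i x x = x"
  by (simp add: join_def vec_eq_iff)

lemma join_zero_in_block: "join own i x 0 \<in> block own i"
  by (simp add: join_def block_def)

lemma join_block: "x \<in> block own i \<Longrightarrow> join own i x 0 = x"
  by (simp add: join_def block_def vec_eq_iff)

lemma join_zero_diff: "join own i (x - y) 0 = join own i x 0 - join own i y 0"
  by (simp add: join_def vec_eq_iff)

lemma inner_join: "g \<in> block own i \<Longrightarrow> g \<bullet> join own i x y = g \<bullet> x"
  unfolding inner_vec_def by (intro sum.cong) (auto simp: join_def block_def)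

lemma continuous_join [continuous_intros]:
  "continuous_on S h \<Longrightarrow> continuous_on S k \<Longrightarrow> continuous_on S (\<lambda>x. join own i (h x) (k x))"
  unfolding join_def
proof (rule continuous_on_vec_lambda)
  fix j
  assume "continuous_on S h" "continuous_on S k"
  then show "continuous_on S (\<lambda>x. if own j = i then h x $ j else k x $ j)"
    by (cases "own j = i") (simp_all add: continuous_on_component)
qed

text \<open>Frees the test point \<open>y\<close> from the restriction to
  \<open>block own i\<close>: the foreign coordinates of \<open>y - x\<close> are annihilated by
  \<open>g\<close>.\<close>

lemma own_subdiffD:
  assumes "g \<in> own_subdiff own i \<phi> x"
  shows "\<phi> (join own i y x) \<ge> \<phi> x + g \<bullet> (y - x)"
proof -
  have g: "g \<in> block own i"
    using assms by (simp add: own_subdiff_def)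
  have "\<phi> (join own i (join own i y 0) x) \<ge> \<phi> x + g \<bullet> (join own i y 0 - join own i x 0)"
    using assms join_zero_in_block[of own i y] unfolding own_subdiff_def by blast
  then show ?thesis
    by (simp add: inner_diff_right inner_join[OF g])
qed

text \<open>Both base points share the foreign coordinates of \<open>x\<close>, so each serves as
  test point for the other; add the two subgradient inequalities.\<close>

lemma own_subdiff_monotone:
  assumes "g \<in> own_subdiff own i \<phi> x" and "h \<in> own_subdiff own i \<phi> (join own i y x)"
  shows "(g - h) \<bullet> (x - y) \<ge> 0"
proof -
  have h: "h \<in> block own i"
    using assms(2) by (simp add: own_subdiff_def)
  then show ?thesis
    using own_subdiffD[OF assms(1), of y] own_subdiffD[OF assms(2), of x]
    by (simp add: inner_diff_left inner_diff_right inner_join[OF h])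
qed

lemma GDERIV_unique: "GDERIV f x :> g \<Longrightarrow> GDERIV f x :> h \<Longrightarrow> g = h"
  unfolding gderiv_def by (metis has_derivative_unique inner_commute vector_eq_ldot)

text \<open>The remainder of the first-order expansion lies between \<open>0\<close> and \<open>(g y - g x) \<bullet> (y - x)\<close>.\<close>

lemma GDERIV_continuous_subgradient:
  fixes \<phi> :: "'v::real_inner \<Rightarrow> real"
  assumes sub: "\<And>x y. \<phi> y \<ge> \<phi> x + g x \<bullet> (y - x)" and cont: "isCont g x"
  shows "GDERIV \<phi> x :> g x"
  unfolding gderiv_def has_derivative_iff_norm
proof
  show "bounded_linear (\<lambda>h. h \<bullet> g x)" by (rule bounded_linear_inner_left)
next
  let ?R = "\<lambda>y. norm (\<phi> y - \<phi> x - (y - x) \<bullet> g x) / norm (y - x)"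
  have bound: "norm (?R y) \<le> norm (g y - g x)" for y
  proof -
    have "\<phi> y - \<phi> x - g x \<bullet> (y - x) \<le> (g y - g x) \<bullet> (y - x)"
      using sub[of y x] by (simp add: inner_diff_left inner_diff_right)
    also have "\<dots> \<le> norm (g y - g x) * norm (y - x)"
      by (rule norm_cauchy_schwarz)
    finally have "norm (\<phi> y - \<phi> x - g x \<bullet> (y - x)) \<le> norm (g y - g x) * norm (y - x)"
      using sub[of x y] by simp
    then show ?thesis
      by (cases "y = x") (simp_all add: divide_le_eq inner_commute)
  qed
  have "((\<lambda>y. g y - g x) \<longlongrightarrow> 0) (at x)"
    using cont LIM_zero unfolding isCont_def by blast
  then have "((\<lambda>y. norm (g y - g x)) \<longlongrightarrow> 0) (at x)"
    by (rule tendsto_norm_zero)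
  then show "(?R \<longlongrightarrow> 0) (at x)"
    by (rule Lim_null_comparison[rotated]) (use bound in simp)
qed

lemma own_grad_eq:
  assumes sub: "\<And>x. g x \<in> own_subdiff own i \<phi> x" and cont: "continuous_on UNIV g"
  shows "own_grad own i \<phi> x = g x"
proof -
  \<comment> \<open>Freezing the foreign coordinates at \<open>x\<close> turns own subgradients into
    subgradients of a function on the whole space; \<open>join own i x x = x\<close> gives
    \<open>?g x = g x\<close>.\<close>
  let ?g = "\<lambda>y. g (join own i y x)"
  have "GDERIV (\<lambda>y. \<phi> (join own i y x)) x :> ?g x"
  proof (rule GDERIV_continuous_subgradient[where g = ?g])
    fix a b
    have "g (join own i a x) \<in> block own i"
      using sub by (auto simp: own_subdiff_def)
    then show "\<phi> (join own i b x) \<ge> \<phi> (join own i a x) + ?g a \<bullet> (b - a)"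
      using own_subdiffD[OF sub[of "join own i a x"], of b]
      by (simp add: inner_diff_right inner_join)
  next
    have "continuous_on UNIV ?g"
      by (rule continuous_on_compose2[OF cont]) (auto intro: continuous_intros)
    then show "isCont ?g x"
      by (simp add: continuous_on_eq_continuous_at)
  qed
  then show ?thesis
    unfolding own_grad_def by (auto intro: GDERIV_unique)
qed

text \<open>Minty's trick: test with \<open>y = x - t d\<close> for \<open>d = T x - u\<close> and let \<open>t\<close> tend to \<open>0\<close>.\<close>

lemma continuous_monotone_related_eq:
  fixes T :: "'v::real_inner \<Rightarrow> 'v"
  assumes cont: "isCont T x" and mono: "\<And>y. (u - T y) \<bullet> (x - y) \<ge> 0"
  shows "u = T x"
proof -
  define d where "d = T x - u"
  have "isCont (\<lambda>t. (u - T (x - t *\<^sub>R d)) \<bullet> d) 0"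
    by (intro continuous_intros isCont_o2[of _ "\<lambda>t. x - t *\<^sub>R d" T]) (use cont in auto)
  then have "((\<lambda>t. (u - T (x - t *\<^sub>R d)) \<bullet> d) \<longlongrightarrow> (u - T x) \<bullet> d) (at_right 0)"
    by (auto simp: isCont_def intro: tendsto_within_subset)
  \<comment> \<open>Here \<open>x - y = t *\<^sub>R d\<close>, and the positive factor
    \<open>t\<close> cancels.\<close>
  moreover have "(u - T (x - t *\<^sub>R d)) \<bullet> d \<ge> 0" if "t > 0" for t :: real
    using mono[of "x - t *\<^sub>R d"] that by (simp add: zero_le_mult_iff)
  then have "\<forall>\<^sub>F t in at_right 0. (u - T (x - t *\<^sub>R d)) \<bullet> d \<ge> 0"
    by (auto simp: eventually_at_right_less intro: eventually_mono[OF eventually_at_right_less])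
  ultimately have "(u - T x) \<bullet> d \<ge> 0"
    by (intro tendsto_lowerbound) auto
  also have "(u - T x) \<bullet> d = - (d \<bullet> d)"
    by (simp add: d_def inner_diff_left inner_diff_right inner_commute)
  finally have "d \<bullet> d = 0"
    using inner_ge_zero[of d] by linarith
  then show ?thesis
    by (simp add: d_def)
qed

lemma monotone_op_single:
  "monotone_op (\<lambda>x. {T x}) \<longleftrightarrow> (\<forall>x y. (T x - T y) \<bullet> (x - y) \<ge> 0)"
  by (auto simp: monotone_op_def op_graph_def)

text \<open>Every pair in the graph of a monotone extension is monotonically related to the whole
  graph of \<open>T\<close>, so Minty's trick puts it on that graph.\<close>

lemma maximally_monotone_op_continuous:
  fixes T :: "'v::real_inner \<Rightarrow> 'v"
  assumes cont: "continuous_on UNIV T"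
  shows "maximally_monotone_op (\<lambda>x. {T x}) \<longleftrightarrow> (\<forall>x y. (T x - T y) \<bullet> (x - y) \<ge> 0)"
proof -
  have "op_graph B \<subseteq> op_graph (\<lambda>x. {T x})"
    if B: "monotone_op B" and le: "op_graph (\<lambda>x. {T x}) \<subseteq> op_graph B" for B
  proof (clarsimp simp: op_graph_def)
    fix x u assume u: "u \<in> B x"
    have "T y \<in> B y" for y
      using le by (auto simp: op_graph_def)
    with u B have "(u - T y) \<bullet> (x - y) \<ge> 0" for y
      unfolding monotone_op_def op_graph_def by fast
    moreover have "isCont T x"
      using cont by (simp add: continuous_on_eq_continuous_at)
    ultimately show "u = T x"
      by (intro continuous_monotone_related_eq)
  qed
  then show ?thesis
    unfolding maximally_monotone_op_def monotone_op_single by blast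
qed

lemma transpose_selection_inner:
  "(transpose (selection own) *v u) \<bullet> z = (\<Sum>k\<in>UNIV. u $ k * z $ (own k, k))"
proof -
  have "(transpose (selection own) *v u) \<bullet> z = u \<bullet> (selection own *v z)"
    by (metis dot_lmul_matrix transpose_matrix_vector)
  then show ?thesis
    by (simp add: selection_mult inner_vec_def)
qed

text \<open>Each coordinate has exactly one owner, so after swapping the sums the inner one
  collapses. This regroups a sum over coordinates by agents.\<close>

lemma sum_join_zero_inner:
  fixes own :: "'m::finite \<Rightarrow> 'a::finite"
  shows "(\<Sum>i\<in>UNIV. join own i (u i) 0 \<bullet> v i) = (\<Sum>k\<in>UNIV. u (own k) $ k * v (own k) $ k)"
proof -
  have "(\<Sum>i\<in>UNIV. join own i (u i) 0 \<bullet> v i)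
      = (\<Sum>i\<in>UNIV. \<Sum>k\<in>UNIV. if own k = i then u i $ k * v i $ k else 0)"
    unfolding inner_vec_def by (intro sum.cong) (auto simp: join_def)
  also have "\<dots> = (\<Sum>k\<in>UNIV. \<Sum>i\<in>UNIV. if own k = i then u i $ k * v i $ k else 0)"
    by (rule sum.swap)
  finally show ?thesis by simp
qed

text \<open>The game mapping is a product of own subdifferentials, and a product that is a singleton
  has singleton factors: exchanging block \<open>i\<close> of \<open>u\<close> for another
  subgradient \<open>h\<close> stays in the product.\<close>

lemma game_map_singleton_own_subdiff:
  assumes "game_map own f x = {u}"
  shows "own_subdiff own i (f i) x = {join own i u 0}"
proof -
  have mem: "join own j u 0 \<in> own_subdiff own j (f j) x" for j
    using assms by (auto simp: game_map_def)
  have "h = join own i u 0" if h: "h \<in> own_subdiff own i (f i) x" for h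
  proof -
    have hi: "join own i h 0 = h"
      using h by (intro join_block) (simp add: own_subdiff_def)
    have "join own j (join own i h u) 0 \<in> own_subdiff own j (f j) x" for j
    proof (cases "j = i")
      case True
      then show ?thesis using h hi by simp
    next
      case False
      then have "join own j (join own i h u) 0 = join own j u 0"
        by (auto simp: join_def vec_eq_iff)
      then show ?thesis using mem by simp
    qed
    then have "join own i h u \<in> game_map own f x"
      by (simp add: game_map_def)
    then have "join own i h u = u"
      using assms by simp
    then show ?thesis
      using hi by (metis join_join_left)
  qed
  with mem show ?thesis by blast
qed

theorem proposition2:
  fixes own :: "'m::finite \<Rightarrow> 'a::finite"
    and X :: "'a \<Rightarrow> (real ^ 'm) set"
    and f :: "'a \<Rightarrow> real ^ 'm \<Rightarrow> real"
  assumes strategies: "\<And>i. X i \<subseteq> block own i" "\<And>i. X i \<noteq> {}" "\<And>i. closed (X i)" "\<And>i. convex (X i)"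
    and f_cont: "\<And>i. continuous_on UNIV (f i)"
    and f_convex: "\<And>i x. convex_on (block own i) (\<lambda>y. f i (join own i y x))"
    and single_valued: "\<And>x. is_singleton (game_map own f x)"
    and F_cont: "continuous_on UNIV (\<lambda>x. the_elem (game_map own f x))"
  shows "maximally_monotone_op
           (\<lambda>z. (\<lambda>u. transpose (selection own) *v u) ` ext_game_map own f z)
         \<longleftrightarrow> (\<forall>i x y y'. own_grad own i (f i) (join own i x y) = own_grad own i (f i) (join own i x y'))"
proof -
  define G where "G x = the_elem (game_map own f x)" for x
  define g where "g i x = join own i (G x) 0" for i x
  \<comment> \<open>The single value of the extended game mapping: each coordinate is evaluated at
    its owner's estimate.\<close>
  define U where "U z = (\<chi> k. G (estimate (own k) z) $ k)" for z :: "real ^ ('a \<times> 'm)"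
  define T where "T z = transpose (selection own) *v U z" for z
  have contG: "continuous_on UNIV G"
    using F_cont unfolding G_def .
  have subdiff: "own_subdiff own i (f i) x = {g i x}" for i x
    unfolding g_def G_def using single_valued[of x]
    by (intro game_map_singleton_own_subdiff) (simp add: is_singleton_the_elem)
  have contg: "continuous_on UNIV (g i)" for i
    unfolding g_def by (intro continuous_intros contG)
  have grad: "own_grad own i (f i) x = g i x" for i x
    by (rule own_grad_eq) (simp_all add: subdiff contg)
  have "ext_game_map own f z = {U z}" for z
    by (auto simp: ext_game_map_def subdiff g_def U_def join_def vec_eq_iff)
  then have op: "(\<lambda>z. (\<lambda>u. transpose (selection own) *v u) ` ext_game_map own f z) = (\<lambda>z. {T z})"
    by (simp add: T_def)
  have "continuous_on UNIV (\<lambda>z. G (estimate i z))" for i :: 'a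
    unfolding estimate_def
    by (rule continuous_on_compose2[OF contG]) (auto intro!: continuous_intros)
  then have contT: "continuous_on UNIV T"
    unfolding T_def U_def
    by (intro continuous_on_compose2[OF matrix_vector_mult_linear_continuous_on[of UNIV]]
        continuous_intros) auto
  have T_inner: "(T z - T w) \<bullet> (z - w) =
      (\<Sum>i\<in>UNIV. (g i (estimate i z) - g i (estimate i w)) \<bullet> (estimate i z - estimate i w))" for z w
  proof -
    have "(T z - T w) \<bullet> (z - w) = (transpose (selection own) *v (U z - U w)) \<bullet> (z - w)"
      by (simp add: T_def matrix_vector_mult_diff_distrib)
    also have "\<dots> = (\<Sum>i\<in>UNIV. join own i (G (estimate i z) - G (estimate i w)) 0
        \<bullet> (estimate i z - estimate i w))"
      unfolding transpose_selection_inner sum_join_zero_inner by (simp add: U_def estimate_def)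
    finally show ?thesis
      by (simp add: g_def join_zero_diff)
  qed
  have "(\<forall>z w. (T z - T w) \<bullet> (z - w) \<ge> 0)
      \<longleftrightarrow> (\<forall>i x y. (g i x - g i y) \<bullet> (x - y) \<ge> 0)" (is "?L \<longleftrightarrow> ?R")
  proof
    assume L: ?L
    show ?R
    proof (intro allI)
      fix i x y
      \<comment> \<open>Only agent \<open>i\<close> has a nonzero estimate, so the terms of all
        other agents vanish and the \<open>i\<close>-th inequality is isolated.\<close>
      define e where "e v = (\<chi> p :: 'a \<times> 'm. if fst p = i then v $ snd p else 0)" for v :: "real ^ 'm"
      have e: "estimate j (e v) = (if j = i then v else 0)" for j v
        by (simp add: e_def estimate_def vec_eq_iff)
      have "(T (e x) - T (e y)) \<bullet> (e x - e y) =
          (\<Sum>j\<in>UNIV. if j = i then (g j x - g j y) \<bullet> (x - y) else 0)"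
        unfolding T_inner by (intro sum.cong) (auto simp: e)
      then show "(g i x - g i y) \<bullet> (x - y) \<ge> 0"
        using L[rule_format, of "e x" "e y"] by simp
    qed
  next
    assume ?R
    then show ?L
      unfolding T_inner by (simp add: sum_nonneg)
  qed
  also have "\<dots> \<longleftrightarrow> (\<forall>i x y y'. g i (join own i x y) = g i (join own i x y'))"
  proof (intro iffI allI)
    fix i x y y'
    assume R: "\<forall>i x y. (g i x - g i y) \<bullet> (x - y) \<ge> 0"
    show "g i (join own i x y) = g i (join own i x y')"
    \<comment> \<open>Minty's trick on the slice with foreign coordinates \<open>y'\<close>, with
      the value from the slice of \<open>y\<close> as \<open>u\<close>. The difference of values
      lies in \<open>block own i\<close>, so the mismatch of \<open>y\<close> and \<open>y'\<close>
      does not enter the pairing.\<close>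
    proof (rule continuous_monotone_related_eq[where T = "\<lambda>v. g i (join own i v y')"])
      have "continuous_on UNIV (\<lambda>v. g i (join own i v y'))"
        by (rule continuous_on_compose2[OF contg]) (auto intro: continuous_intros)
      then show "isCont (\<lambda>v. g i (join own i v y')) x"
        by (simp add: continuous_on_eq_continuous_at)
    next
      fix v
      let ?h = "g i (join own i x y) - g i (join own i v y')"
      have "?h \<in> block own i"
        by (simp add: g_def join_zero_diff[symmetric] join_zero_in_block)
      then show "?h \<bullet> (x - v) \<ge> 0"
        using R[rule_format, of i "join own i x y" "join own i v y'"]
        by (simp add: inner_diff_right inner_join)
    qed
  next
    fix i x y
    assume indep: "\<forall>i x y y'. g i (join own i x y) = g i (join own i x y')"
    \<comment> \<open>Moving \<open>y\<close> to the foreign coordinates of \<open>x\<close> makes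
      both values subgradients of one function of the own strategy.\<close>
    have "g i y = g i (join own i y x)"
      using indep[rule_format, of i y y x] by simp
    then show "(g i x - g i y) \<bullet> (x - y) \<ge> 0"
      using own_subdiff_monotone[of "g i x" own i "f i" x "g i y" y] by (simp add: subdiff)
  qed
  finally show ?thesis
    unfolding op grad maximally_monotone_op_continuous[OF contT] .
qed

end
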